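(* Let $k,a,b$ be positive integers, $T\in\mathrm{SSYT}_k(a\times b)$, $x\in\{1,\dots,a\}$ a row index and $d\in\mathbb{Z}$. Then, as multisets, \[\mathrm{BCDist}(T,a+1-x,k-d)=\{b-m : m\in\mathrm{BCDist}(T,x,d)\}.\]
   Context: $\mathrm{SSYT}_k(a\times b)$ is the set of semistandard Young tableaux of rectangular shape with $a$ rows and $b$ columns (rows weakly increasing left to right, columns strictly increasing top to bottom) with entries in $\{1,\dots,k\}$; $T(x,j)$ is the entry in row $x$, column $j$. Promotion $\mathrm{Pro}=\rho_{k-1}\circ\cdots\circ\rho_2\circ\rho_1$ is the composition of Bender–Knuth involutions: $\rho_i$ calls an entry $i$ free if there is no $i+1$ directly below it and an entry $i+1$ free if there is no $i$ directly above it; in each row, if the free entries are $r$ copies of $i$ followed by $s$ copies of $i+1$, they are replaced by $s$ copies of $i$ followed by $r$ copies of $i+1$. For a row $x$ and $d\in\mathbb{Z}$, $\mathrm{BCDist}(T,x,d)$ is the multiset $\{\#\{j\in\{1,\dots,b\}:\mathrm{Pro}^i(T)(x,j)>d\} : 0\le i\le k-1\}$. *)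

theory Defs
  imports Main "HOL-Library.Multiset"
begin

text \<open>
  Tableaux are functions of a row index and a column index, both counted from 1.
  Entries outside the \<open>a \<times> b\<close> rectangle are fixed to be \<open>0\<close>, so that a tableau is represented
  by exactly one function.
\<close>

type_synonym tableau = "nat \<Rightarrow> nat \<Rightarrow> nat"

definition SSYT :: "nat \<Rightarrow> nat \<Rightarrow> nat \<Rightarrow> tableau set" where
  "SSYT k a b = {T.
     (\<forall>x\<in>{1..a}. \<forall>j\<in>{1..b}. T x j \<in> {1..k}) \<and>
     (\<forall>x\<in>{1..a}. \<forall>j\<in>{1..b}. \<forall>j'\<in>{1..b}. j < j' \<longrightarrow> T x j \<le> T x j') \<and>
     (\<forall>x\<in>{1..a}. \<forall>x'\<in>{1..a}. \<forall>j\<in>{1..b}. x < x' \<longrightarrow> T x j < T x' j) \<and>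
     (\<forall>x j. x \<notin> {1..a} \<or> j \<notin> {1..b} \<longrightarrow> T x j = 0)}"

definition free_low :: "nat \<Rightarrow> nat \<Rightarrow> nat \<Rightarrow> tableau \<Rightarrow> nat \<Rightarrow> nat set" where
  "free_low a b i T x =
     {j \<in> {1..b}. x \<in> {1..a} \<and> T x j = i \<and> \<not> (x + 1 \<le> a \<and> T (x + 1) j = i + 1)}"

definition free_high :: "nat \<Rightarrow> nat \<Rightarrow> nat \<Rightarrow> tableau \<Rightarrow> nat \<Rightarrow> nat set" where
  "free_high a b i T x =
     {j \<in> {1..b}. x \<in> {1..a} \<and> T x j = i + 1 \<and> \<not> (2 \<le> x \<and> T (x - 1) j = i)}"

text \<open>
  In row \<open>x\<close> the free entries \<open>i\<close> occupy the columns \<open>free_low\<close> (there are \<open>r\<close> of them) and the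
  free entries \<open>i + 1\<close> the columns \<open>free_high\<close> (there are \<open>s\<close> of them). Refilling the free
  positions, from left to right, with \<open>s\<close> copies of \<open>i\<close> and then \<open>r\<close> copies of \<open>i + 1\<close> means that
  a free position receives \<open>i\<close> iff fewer than \<open>s\<close> free positions of its row lie to its left.
\<close>

definition bender_knuth :: "nat \<Rightarrow> nat \<Rightarrow> nat \<Rightarrow> tableau \<Rightarrow> tableau" where
  "bender_knuth a b i T = (\<lambda>x j.
     let F = free_low a b i T x \<union> free_high a b i T x;
         s = card (free_high a b i T x)
     in if j \<in> F then (if card {j' \<in> F. j' < j} < s then i else i + 1) else T x j)"

text \<open>\<^const>\<open>fold\<close> applies the involution with index \<open>1\<close> first and the one with index \<open>k - 1\<close> last.\<close>

definition promotion :: "nat \<Rightarrow> nat \<Rightarrow> nat \<Rightarrow> tableau \<Rightarrow> tableau" where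
  "promotion k a b = fold (bender_knuth a b) [1..<k]"

definition BCDist :: "nat \<Rightarrow> nat \<Rightarrow> nat \<Rightarrow> tableau \<Rightarrow> nat \<Rightarrow> int \<Rightarrow> nat multiset" where
  "BCDist k a b T x d =
     image_mset (\<lambda>i. card {j \<in> {1..b}. int ((promotion k a b ^^ i) T x j) > d}) (mset_set {0..<k})"

end

theory Submission
  imports Defs Complex_Main
begin

text \<open>
  Let \<open>N\<^sub>t(x, e)\<close> be the number of entries at most \<open>e\<close> in row \<open>x\<close> of \<open>Pro\<^sup>t(T)\<close>. Everything follows from
  the complementation rule \<open>N\<^bsub>t+e\<^esub>(a + 1 - x, k - e) = b - N\<^sub>t(x, e)\<close>: applied twice it shows that the
  counts have period \<open>k\<close> in \<open>t\<close>, so that the shift by \<open>e\<close> does not change the multiset.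

  In terms of the counts, a Bender-Knuth involution is a piecewise linear toggle, so promotion is
  the tropicalisation of birational promotion on the rectangle poset \<open>a \<times> (k - a)\<close>, and the rule is
  the tropical form of Grinberg and Roby's reciprocity for birational rowmotion. Over the positive
  reals the labels are sums over lattice paths; a conversion identity that shifts such sums by one
  column and one time step gives the reciprocity on the top row, and the remaining rows follow by
  solving the toggle relation for the row below. That step divides and subtracts, which is why it
  is carried out over the reals and only then tropicalised by comparing growth rates.
\<close>

section \<open>Path sums on a labelled rectangle\<close>

text \<open>For \<open>1 \<le> l\<close> and \<open>1 \<le> i\<close>, the sum over monotone lattice
  paths from \<open>(1, l)\<close> to \<open>(i, j)\<close> of the product of the vertex weights.
  Row \<open>0\<close> only marks the starting column.\<close>

fun path_sum :: "(nat \<Rightarrow> nat \<Rightarrow> real) \<Rightarrow> nat \<Rightarrow> nat \<Rightarrow> nat \<Rightarrow> real" where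
  "path_sum s l 0 j = (if j = l then 1 else 0)"
| "path_sum s l (Suc i) 0 = 0"
| "path_sum s l (Suc i) (Suc j) = s (Suc i) (Suc j) * (path_sum s l i (Suc j) + path_sum s l (Suc i) j)"

text \<open>These two weights compare a label with its lower covers and, dually, with its upper
  covers. One rowmotion step turns the first into the second.\<close>

definition down_weight :: "(nat \<Rightarrow> nat \<Rightarrow> real) \<Rightarrow> nat \<Rightarrow> nat \<Rightarrow> real" where
  "down_weight F i j = F i j / (F (i - 1) j + F i (j - 1))"

definition up_weight :: "(nat \<Rightarrow> nat \<Rightarrow> real) \<Rightarrow> nat \<Rightarrow> nat \<Rightarrow> real" where
  "up_weight F i j = 1 / (F i j * (inverse (F (Suc i) j) + inverse (F i (Suc j))))"

lemma path_sum_step: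
  assumes "1 \<le> i" "1 \<le> j"
  shows "path_sum s l i j = s i j * (path_sum s l (i - 1) j + path_sum s l i (j - 1))"
proof -
  obtain i' j' where "i = Suc i'" "j = Suc j'" using assms by (metis Suc_le_D One_nat_def)
  then show ?thesis by simp
qed

lemma path_sum_col0 [simp]: "1 \<le> i \<Longrightarrow> path_sum s l i 0 = 0"
  by (cases i) auto

lemma path_sum_left: "j < l \<Longrightarrow> path_sum s l i j = 0"
  by (induction s l i j rule: path_sum.induct) auto

lemma path_sum_cong:
  assumes "\<And>i j. \<lbrakk>1 \<le> i; i \<le> m; 1 \<le> j; j \<le> n\<rbrakk> \<Longrightarrow> s i j = s' i j"
    and "i \<le> m" "j \<le> n"
  shows "path_sum s l i j = path_sum s' l i j"
  using assms(2,3)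
proof (induction "i + j" arbitrary: i j rule: less_induct)
  case less
  show ?case
  proof (cases "i = 0 \<or> j = 0")
    case False
    then have "1 \<le> i" "1 \<le> j" by auto
    from path_sum_step[OF this] show ?thesis
      using less.hyps[of "i - 1" j] less.hyps[of i "j - 1"] less.prems False assms(1)[of i j] by simp
  next
    case True
    then show ?thesis by (cases i) auto
  qed
qed

text \<open>\<open>h\<close> acts as a potential: the hypotheses make the two path sums entering a
  vertex equal to \<open>F i j\<close> times differences of \<open>h\<close>. Their sum telescopes,
  and \<open>up_weight F i j\<close> replaces \<open>F i j\<close> by
  \<open>1 / \<kappa> i j\<close>.\<close>

lemma up_path_sum_eq:
  fixes F h :: "nat \<Rightarrow> nat \<Rightarrow> real"
  defines "\<kappa> \<equiv> \<lambda>i j. inverse (F (Suc i) j) + inverse (F i (Suc j))"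
  assumes F: "\<And>i j. \<lbrakk>1 \<le> i; i \<le> p; 1 \<le> j; j \<le> n\<rbrakk> \<Longrightarrow> F i j \<noteq> 0"
    and s1: "\<And>i j. \<lbrakk>1 \<le> i; i \<le> p; 1 \<le> j; j \<le> n\<rbrakk> \<Longrightarrow> F i j * (h i (Suc j) - h i j) =
       (if i = 1 then (if j = l then 1 else 0) else (h (i - 1) (Suc j) - h i j) / \<kappa> (i - 1) j)"
    and s2: "\<And>i j. \<lbrakk>1 \<le> i; i \<le> p; 1 \<le> j; j \<le> n\<rbrakk> \<Longrightarrow> F i j * (h i j - h (Suc i) j) =
       (if j = 1 then 0 else (h i j - h (Suc i) (j - 1)) / \<kappa> i (j - 1))"
    and ij: "1 \<le> i" "i \<le> p" "1 \<le> j" "j \<le> n"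
  shows "path_sum (up_weight F) l i j = (h i (Suc j) - h (Suc i) j) / \<kappa> i j"
  using ij
proof (induction "i + j" arbitrary: i j rule: less_induct)
  case less
  have 1: "path_sum (up_weight F) l (i - 1) j = F i j * (h i (Suc j) - h i j)"
  proof (cases "i = 1")
    case False
    then show ?thesis using less.prems less.hyps[of "i - 1" j] by (simp add: s1)
  qed (use less.prems in \<open>simp add: s1\<close>)
  have 2: "path_sum (up_weight F) l i (j - 1) = F i j * (h i j - h (Suc i) j)"
  proof (cases "j = 1")
    case False
    then show ?thesis using less.prems less.hyps[of i "j - 1"] by (simp add: s2)
  qed (use less.prems in \<open>simp add: s2\<close>)
  have "path_sum (up_weight F) l i j = up_weight F i j * (F i j * (h i (Suc j) - h (Suc i) j))"
    using less.prems unfolding path_sum_step[OF less.prems(1,3)] 1 2 by (simp add: algebra_simps)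
  also have "\<dots> = (h i (Suc j) - h (Suc i) j) / \<kappa> i j"
    using F[OF less.prems] by (simp add: up_weight_def \<kappa>_def)
  finally show ?case .
qed

section \<open>Labellings and the passage from down weights to up weights\<close>

lemma divide_inverse_right: "x / inverse y = y * x" for x y :: real
  by (simp add: divide_inverse)

text \<open>The bound \<open>N\<close> limits positivity to the first columns, since at time
  \<open>c\<close> of rowmotion only the columns \<open>j \<le> c\<close> are constrained.\<close>

locale labelling =
  fixes p q :: nat and C :: real and F :: "nat \<Rightarrow> nat \<Rightarrow> real" and N :: nat
  assumes pos: "\<And>i j. \<lbrakk>1 \<le> i; i \<le> p; 1 \<le> j; j \<le> N\<rbrakk> \<Longrightarrow> 0 < F i j"
    and p1: "1 \<le> p" and Nq: "N \<le> q" and C: "0 < C"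
    and left [simp]: "\<And>i. F i 0 = 0"
    and bottom [simp]: "\<And>j. 1 \<le> j \<Longrightarrow> F 0 j = (if j = 1 then 1 else 0)"
    and right [simp]: "\<And>i. \<lbrakk>1 \<le> i; i \<le> p\<rbrakk> \<Longrightarrow> F i (Suc q) = 0"
    and top [simp]: "\<And>j. 1 \<le> j \<Longrightarrow> F (Suc p) j = (if j = q then C else 0)"
begin

lemma nonneg: "\<lbrakk>i \<le> p; j \<le> N\<rbrakk> \<Longrightarrow> 0 \<le> F i j"
  using pos[of i j] by (cases "i = 0"; cases "j = 0") force+

lemma down_pos: "\<lbrakk>1 \<le> i; i \<le> p; 1 \<le> j; j \<le> N\<rbrakk> \<Longrightarrow> 0 < F (i - 1) j + F i (j - 1)"
proof -
  assume ij: "1 \<le> i" "i \<le> p" "1 \<le> j" "j \<le> N"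
  consider "i \<ge> 2" | "j \<ge> 2" | "i = 1" "j = 1" using ij by linarith
  then show ?thesis
  proof cases
    case 1
    then have "0 < F (i - 1) j" using ij by (intro pos) auto
    moreover have "0 \<le> F i (j - 1)" using ij by (intro nonneg) auto
    ultimately show ?thesis by simp
  next
    case 2
    then have "0 < F i (j - 1)" using ij by (intro pos) auto
    moreover have "0 \<le> F (i - 1) j" using ij by (intro nonneg) auto
    ultimately show ?thesis by simp
  qed simp
qed

text \<open>Multiplying \<open>down_weight F\<close> by the sum over the lower covers returns
  \<open>F\<close>, so both sides obey one recurrence; the bottom row of \<open>F\<close> marks
  column \<open>1\<close> as the source.\<close>

lemma path_sum_down:
  assumes "i \<le> p" "1 \<le> j \<or> 1 \<le> i" "j \<le> N"
  shows "path_sum (down_weight F) 1 i j = F i j"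
  using assms
proof (induction "i + j" arbitrary: i j rule: less_induct)
  case less
  show ?case
  proof (cases "i = 0 \<or> j = 0")
    case False
    then show ?thesis
      using less.prems less.hyps[of "i - 1" j] less.hyps[of i "j - 1"] down_pos[of i j]
      by (simp add: path_sum_step down_weight_def)
  qed (use less.prems in auto)
qed

text \<open>A quotient of two solutions of the \<open>down_weight\<close> recurrence, as
  \<open>F\<close> is itself a path sum. Away from the boundary it is a weighted average of its
  values at the lower covers, that is, harmonic.\<close>

definition harm :: "nat \<Rightarrow> nat \<Rightarrow> nat \<Rightarrow> real" where
  "harm l i j = path_sum (down_weight F) (Suc l) i j / F i j"

lemma harm_step:
  assumes "1 \<le> i" "i \<le> p" "1 \<le> j" "j \<le> N"
  shows "harm l i j * (F (i - 1) j + F i (j - 1))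
    = path_sum (down_weight F) (Suc l) (i - 1) j + path_sum (down_weight F) (Suc l) i (j - 1)"
  using assms pos[of i j] down_pos[of i j]
  by (simp add: harm_def path_sum_step[of i j] down_weight_def)

lemma path_harm:
  assumes "1 \<le> i" "i \<le> p" "j \<le> N"
  shows "path_sum (down_weight F) (Suc l) i j = F i j * harm l i j"
  using assms pos[of i j] by (cases "j = 0") (simp_all add: harm_def)

text \<open>The two relations say that \<open>harm\<close> differs along a cover relation by the amount of a flow
  carried by the opposite covers.\<close>

lemma harm_right:
  assumes "1 \<le> i" "i \<le> p" "1 \<le> j" "Suc j \<le> N"
  shows "F i j * (harm l i (Suc j) - harm l i j) =
    (if i = 1 then (if j = l then 1 else 0)
     else (harm l (i - 1) (Suc j) - harm l i j) / (inverse (F i j) + inverse (F (i - 1) (Suc j))))"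
proof (cases "i = 1")
  case True
  then show ?thesis using assms harm_step[of i "Suc j" l] path_harm[of i j l]
    by (auto simp: algebra_simps)
next
  case False
  define u v where "u = F i j" and "v = F (i - 1) (Suc j)"
  have uv: "u > 0" "v > 0" using pos assms False by (auto simp: u_def v_def)
  have "harm l i (Suc j) * (v + u) = v * harm l (i - 1) (Suc j) + u * harm l i j"
    using assms False harm_step[of i "Suc j" l] path_harm[of i j l] path_harm[of "i - 1" "Suc j" l]
    by (simp add: u_def v_def)
  then have "u * (harm l i (Suc j) - harm l i j) =
      (harm l (i - 1) (Suc j) - harm l i j) / (inverse u + inverse v)"
    using uv by (simp add: field_simps)
  then show ?thesis using False by (simp add: u_def v_def)
qed

lemma harm_down:
  assumes "1 \<le> i" "Suc i \<le> p" "1 \<le> j" "j \<le> N"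
  shows "F i j * (harm l i j - harm l (Suc i) j) =
    (if j = 1 then 0
     else (harm l i j - harm l (Suc i) (j - 1)) / (inverse (F (Suc i) (j - 1)) + inverse (F i j)))"
proof (cases "j = 1")
  case True
  then show ?thesis using assms harm_step[of "Suc i" j l] path_harm[of i j l]
    by (auto simp: algebra_simps)
next
  case False
  define u v where "u = F i j" and "v = F (Suc i) (j - 1)"
  have uv: "u > 0" "v > 0" using pos assms False by (auto simp: u_def v_def)
  have "harm l (Suc i) j * (u + v) = u * harm l i j + v * harm l (Suc i) (j - 1)"
    using assms False harm_step[of "Suc i" j l] path_harm[of i j l] path_harm[of "Suc i" "j - 1" l]
    by (simp add: u_def v_def)
  then have "u * (harm l i j - harm l (Suc i) j) =
      (harm l i j - harm l (Suc i) (j - 1)) / (inverse v + inverse u)"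
    using uv by (simp add: field_simps)
  then show ?thesis using False by (simp add: u_def v_def)
qed

text \<open>The potential is \<open>harm l\<close>, extended by \<open>0\<close> above row
  \<open>p\<close>. As \<open>j < q\<close>, the label above \<open>(p, j)\<close> is
  \<open>0\<close> and so is its inverse, which leaves \<open>inverse (F p (Suc j))\<close> as the
  denominator in \<open>up_path_sum_eq\<close>.\<close>

lemma path_sum_convert:
  assumes "1 \<le> j" "Suc j \<le> N" "1 \<le> l"
  shows "path_sum (up_weight F) l p j = path_sum (down_weight F) (Suc l) p (Suc j)"
proof -
  define h where "h = (\<lambda>i j. if i \<le> p then harm l i j else 0)"
  have "path_sum (up_weight F) l p j =
      (h p (Suc j) - h (Suc p) j) / (inverse (F (Suc p) j) + inverse (F p (Suc j)))"
  proof (rule up_path_sum_eq[where n = j and p = p])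
    show "F i j' \<noteq> 0" if "1 \<le> i" "i \<le> p" "1 \<le> j'" "j' \<le> j" for i j'
      using pos[of i j'] that assms by simp
  next
    fix i j' assume ij: "1 \<le> i" "i \<le> p" "1 \<le> j'" "j' \<le> j"
    show "F i j' * (h i (Suc j') - h i j') = (if i = 1 then (if j' = l then 1 else 0) else
        (h (i - 1) (Suc j') - h i j') / (inverse (F (Suc (i - 1)) j') + inverse (F (i - 1) (Suc j'))))"
      using harm_right[of i j' l] ij assms by (auto simp: h_def)
    show "F i j' * (h i j' - h (Suc i) j') = (if j' = 1 then 0 else
        (h i j' - h (Suc i) (j' - 1)) / (inverse (F (Suc i) (j' - 1)) + inverse (F i (Suc (j' - 1)))))"
    proof (cases "i = p")
      case True
      have "j' - 1 \<noteq> q" using ij assms Nq by simp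
      moreover have "harm l p 1 = 0" if "j' = 1"
        using that assms by (simp add: harm_def path_sum_left)
      ultimately show ?thesis using True ij assms Nq by (auto simp: h_def field_simps)
    next
      case False
      then show ?thesis using harm_down[of i j' l] ij assms by (simp add: h_def)
    qed
  qed (use assms p1 in auto)
  also have "\<dots> = h p (Suc j) * F p (Suc j)"
    using assms Nq p1 by (simp add: h_def divide_inverse_right)
  also have "\<dots> = path_sum (down_weight F) (Suc l) p (Suc j)"
    using path_harm[of p "Suc j" l] assms p1 by (simp add: h_def)
  finally show ?thesis .
qed

text \<open>Along the bottom row the down weights telescope, so to the right of column
  \<open>l\<close> the path sum is \<open>F 1 j / F 1 l\<close>.\<close>

lemma harm_bottom:
  assumes "1 \<le> l" "1 \<le> j" "j \<le> N"
  shows "harm l 1 j = (if l < j then inverse (F 1 l) else 0)"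
  using assms(2,3)
proof (induction j)
  case (Suc j)
  show ?case
  proof (cases "j = 0")
    case False
    have "F 1 j > 0" using pos[of 1 j] False Suc.prems p1 by simp
    moreover have "harm l 1 (Suc j) * F 1 j = (if j = l then 1 else 0) + F 1 j * harm l 1 j"
      using harm_step[of 1 "Suc j" l] path_harm[of 1 j l] Suc.prems False p1 by (simp add: algebra_simps)
    ultimately show ?thesis using Suc False by (auto simp: field_simps split: if_splits)
  qed (use assms in \<open>simp add: harm_def path_sum_left\<close>)
qed simp

lemma path_sum_last:
  assumes "N = q" "1 \<le> l" "l \<le> q"
  shows "path_sum (up_weight F) l p q = C * inverse (F 1 l)"
proof -
  \<comment> \<open>Beyond column \<open>q\<close> the potential keeps the constant that
    \<open>harm l\<close> takes in the bottom row to the right of column \<open>l\<close>. With it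
    both relations persist in column \<open>q\<close>, where the label to the right is
    \<open>0\<close>.\<close>
  define h where "h = (\<lambda>i j. if p < i then 0 else if q < j then inverse (F 1 l) else harm l i j)"
  have "path_sum (up_weight F) l p q =
      (h p (Suc q) - h (Suc p) q) / (inverse (F (Suc p) q) + inverse (F p (Suc q)))"
  proof (rule up_path_sum_eq[where n = q and p = p])
    show "F i j \<noteq> 0" if "1 \<le> i" "i \<le> p" "1 \<le> j" "j \<le> q" for i j
      using pos[of i j] that assms by simp
  next
    fix i j assume ij: "1 \<le> i" "i \<le> p" "1 \<le> j" "j \<le> q"
    have F1: "F 1 l > 0" using pos[of 1 l] assms p1 by simp
    show "F i j * (h i (Suc j) - h i j) = (if i = 1 then (if j = l then 1 else 0) else
        (h (i - 1) (Suc j) - h i j) / (inverse (F (Suc (i - 1)) j) + inverse (F (i - 1) (Suc j))))"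
    proof (cases "j = q")
      case True
      show ?thesis
      proof (cases "i = 1")
        case i1: True
        then show ?thesis using True harm_bottom[of l q] assms ij F1 by (auto simp: h_def)
      next
        case False
        then obtain i' where "i = Suc i'" "1 \<le> i'" "i' \<le> p" using ij by (cases i) auto
        then show ?thesis using True ij
          by (simp add: h_def divide_inverse_right)
      qed
    next
      case False
      then show ?thesis using harm_right[of i j l] ij assms by (auto simp: h_def)
    qed
    show "F i j * (h i j - h (Suc i) j) = (if j = 1 then 0 else
        (h i j - h (Suc i) (j - 1)) / (inverse (F (Suc i) (j - 1)) + inverse (F i (Suc (j - 1)))))"
    proof (cases "i = p")
      case True
      have "j - 1 \<noteq> q" using ij by simp
      moreover have "harm l p 1 = 0" if "j = 1"
        using that assms by (simp add: harm_def path_sum_left)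
      ultimately show ?thesis using True ij assms by (auto simp: h_def field_simps)
    next
      case False
      then show ?thesis using harm_down[of i j l] ij assms by (auto simp: h_def)
    qed
  qed (use assms p1 in auto)
  also have "\<dots> = C * inverse (F 1 l)"
    using assms p1 C by (simp add: h_def divide_inverse_right)
  finally show ?thesis .
qed

end

section \<open>Reciprocity for birational rowmotion\<close>

text \<open>The labels at time \<open>t\<close> of promotion are \<open>F (t + j) i j\<close>; this time shift turns promotion into
  rowmotion. Entries with \<open>c < j\<close> would belong to negative times and are unconstrained.\<close>

locale birational_rowmotion =
  fixes p q :: nat and C :: real and F :: "nat \<Rightarrow> nat \<Rightarrow> nat \<Rightarrow> real"
  assumes pos: "\<And>c i j. \<lbrakk>1 \<le> i; i \<le> p; 1 \<le> j; j \<le> q; j \<le> c\<rbrakk> \<Longrightarrow> 0 < F c i j"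
    and p1: "1 \<le> p" and C: "0 < C"
    and left [simp]: "\<And>c i. F c i 0 = 0"
    and bottom [simp]: "\<And>c j. 1 \<le> j \<Longrightarrow> F c 0 j = (if j = 1 then 1 else 0)"
    and right [simp]: "\<And>c i. \<lbrakk>1 \<le> i; i \<le> p\<rbrakk> \<Longrightarrow> F c i (Suc q) = 0"
    and top [simp]: "\<And>c j. 1 \<le> j \<Longrightarrow> F c (Suc p) j = (if j = q then C else 0)"
    and toggle: "\<And>c i j. \<lbrakk>1 \<le> i; i \<le> p; 1 \<le> j; j \<le> q; j \<le> c\<rbrakk> \<Longrightarrow>
      F (Suc c) i j * F c i j * (inverse (F (Suc c) (Suc i) j) + inverse (F (Suc c) i (Suc j)))
        = F c (i - 1) j + F c i (j - 1)"
begin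

lemma labelling: "N \<le> q \<Longrightarrow> N \<le> c \<Longrightarrow> labelling p q C (F c) N"
  by unfold_locales (use pos p1 C in auto)

text \<open>The toggle relation, rearranged. Its factor \<open>K\<close> cannot vanish because the
  sum over the lower covers is positive.\<close>

lemma weights_eq:
  assumes "1 \<le> i" "i \<le> p" "1 \<le> j" "j \<le> q" "j \<le> c"
  shows "down_weight (F c) i j = up_weight (F (Suc c)) i j"
proof -
  have D: "0 < F c (i - 1) j + F c i (j - 1)"
    using labelling.down_pos[OF labelling[of j c], of i j] assms by simp
  define K where "K = inverse (F (Suc c) (Suc i) j) + inverse (F (Suc c) i (Suc j))"
  have "F (Suc c) i j > 0" "F c i j > 0" using pos assms by auto
  moreover have "K \<noteq> 0" using toggle[OF assms] D by (auto simp: K_def[symmetric])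
  ultimately show ?thesis
    unfolding down_weight_def up_weight_def toggle[OF assms, symmetric] K_def[symmetric] by simp
qed

text \<open>Each step reads down weights as up weights of the next time by
  \<open>weights_eq\<close>; \<open>path_sum_convert\<close> then moves source and target one column
  to the right.\<close>

lemma path_sum_shift:
  assumes "1 \<le> l" "1 \<le> j" "j + n \<le> q" "j \<le> c"
  shows "path_sum (down_weight (F c)) l p j = path_sum (down_weight (F (c + n))) (l + n) p (j + n)"
  using assms(3)
proof (induction n)
  case (Suc n)
  have "path_sum (down_weight (F (c + n))) (l + n) p (j + n)
      = path_sum (up_weight (F (Suc (c + n)))) (l + n) p (j + n)"
  proof (rule path_sum_cong[where m = p and n = "j + n"])
    fix i' j' assume "1 \<le> i'" "i' \<le> p" "1 \<le> j'" "j' \<le> j + n"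
    then show "down_weight (F (c + n)) i' j' = up_weight (F (Suc (c + n))) i' j'"
      using Suc.prems assms by (intro weights_eq) linarith+
  qed simp_all
  also have "\<dots> = path_sum (down_weight (F (Suc (c + n)))) (Suc (l + n)) p (Suc (j + n))"
    by (rule labelling.path_sum_convert[OF labelling[of "Suc (j + n)"]]) (use Suc.prems assms in linarith)+
  finally show ?case using Suc.IH Suc.prems by simp
qed simp

text \<open>Expand \<open>F c p j\<close> as a path sum from column \<open>1\<close>, shift it until
  it ends at the corner \<open>(p, q)\<close>, and evaluate it there by
  \<open>path_sum_last\<close>. The source has then moved to column
  \<open>q + 1 - j\<close>.\<close>

lemma reciprocity_top:
  assumes "1 \<le> j" "j \<le> q" "j \<le> c"
  shows "F (c + (q - j) + 1) 1 (q + 1 - j) = C * inverse (F c p j)"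
proof -
  define n where "n = q - j"
  have q: "q = j + n" and q': "q + 1 - j = 1 + n" using assms by (auto simp: n_def)
  have "F c p j = path_sum (down_weight (F c)) 1 p j"
    by (rule labelling.path_sum_down[OF labelling[of j c], symmetric]) (use assms in linarith)+
  also have "\<dots> = path_sum (down_weight (F (c + n))) (1 + n) p (j + n)"
    by (rule path_sum_shift) (use assms q in linarith)+
  also have "\<dots> = path_sum (up_weight (F (Suc (c + n)))) (1 + n) p (j + n)"
  proof (rule path_sum_cong[where m = p and n = "j + n"])
    fix i' j' assume "1 \<le> i'" "i' \<le> p" "1 \<le> j'" "j' \<le> j + n"
    then show "down_weight (F (c + n)) i' j' = up_weight (F (Suc (c + n))) i' j'"
      using q assms by (intro weights_eq) linarith+
  qed simp_all
  also have "\<dots> = C * inverse (F (Suc (c + n)) 1 (1 + n))"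
    unfolding q[symmetric]
    by (rule labelling.path_sum_last[OF labelling[of q]]) (use assms q in linarith)+
  finally show ?thesis using C unfolding q' n_def[symmetric] by simp
qed

text \<open>The induction carries two adjacent rows, because the toggle relation yields row
  \<open>i + 2\<close> from rows \<open>i\<close> and \<open>i + 1\<close>. It also involves
  neighbouring columns and times, so \<open>j\<close> and \<open>c\<close> vary.\<close>

lemma reciprocity:
  assumes "i \<le> p" "1 \<le> j" "j \<le> q" "j \<le> c"
  shows "F (c + (q - j) + (i + 1)) (i + 1) (q + 1 - j) = C * inverse (F c (p - i) j) \<and>
    F (c + (q - j) + i) i (q + 1 - j) = C * inverse (F c (p + 1 - i) j)"
  using assms
proof (induction i arbitrary: j c)
  case 0
  \<comment> \<open>For row \<open>0\<close> against row \<open>p + 1\<close>, either both labels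
    are \<open>0\<close>, with \<open>inverse 0 = 0\<close>, or the claim reads
    \<open>1 = C / C\<close>.\<close>
  then show ?case using reciprocity_top[of j c] C by auto
next
  case (Suc i)
  define r I M e where "r = p - i" and "I = i + 1" and "M = q + 1 - j" and "e = q - j + (i + 1)"
  have bounds: "1 \<le> r" "r \<le> p" "1 \<le> I" "I \<le> p" "1 \<le> M" "M \<le> q" "M \<le> c + e" "j \<le> c"
    using Suc.prems by (auto simp: r_def I_def M_def e_def)
  have F_c: "F (c + e) I M = C * inverse (F c r j)"
    using Suc.IH[of j c] Suc.prems by (simp add: r_def I_def M_def e_def ac_simps)
  have F_Suc: "F (Suc (c + e)) I M = C * inverse (F (Suc c) r j)"
    using Suc.IH[of j "Suc c"] Suc.prems by (simp add: r_def I_def M_def e_def ac_simps)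
  have down1: "F (c + e) (I - 1) M = C * inverse (F (Suc c) (Suc r) j)"
    using Suc.IH[of j "Suc c"] Suc.prems by (simp add: r_def I_def M_def e_def ac_simps Suc_diff_le)
  have down2: "F (c + e) I (M - 1) = C * inverse (F (Suc c) r (Suc j))"
  proof (cases "j = q")
    case False
    then have "q - j = Suc (q - Suc j)" using Suc.prems by simp
    then show ?thesis
      using Suc.IH[of "Suc j" "Suc c"] Suc.prems False by (simp add: r_def I_def M_def e_def ac_simps)
  qed (use bounds in \<open>simp add: M_def\<close>)
  have up2: "F (Suc (c + e)) I (Suc M) = C * inverse (F c r (j - 1))"
  proof (cases "j = 1")
    case False
    then have "q - (j - 1) = Suc (q - j)" "Suc q - (j - 1) = Suc (Suc q - j)" using Suc.prems by auto
    then show ?thesis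
      using Suc.IH[of "j - 1" c] Suc.prems False by (simp add: r_def I_def M_def e_def ac_simps)
  qed (use bounds in \<open>simp add: M_def\<close>)
  define f g where "f = F c r j" and "g = F (Suc c) r j"
  have fg: "f > 0" "g > 0" using pos bounds Suc.prems by (auto simp: f_def g_def)
  define X Y where "X = F (c + e) (I - 1) M + F (c + e) I (M - 1)"
    and "Y = F (Suc (c + e)) (Suc I) M"
  have X: "X * (g * f) = C * (F c (r - 1) j + F c r (j - 1))"
  proof -
    have "X * (g * f) = C * (g * f * (inverse (F (Suc c) (Suc r) j) + inverse (F (Suc c) r (Suc j))))"
      unfolding X_def down1 down2 by (simp add: algebra_simps)
    then show ?thesis
      using toggle[of r j c] bounds Suc.prems by (simp add: f_def g_def)
  qed
  have "(C * inverse g) * (C * inverse f) * (inverse Y + inverse (C * inverse (F c r (j - 1)))) = X"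
    using toggle[of I M "c + e"] bounds
    by (simp add: F_c F_Suc up2 X_def Y_def f_def g_def)
  then have "X * (g * f) =
      (g * inverse g) * (f * inverse f) * (C * (C * inverse Y + (C * inverse C) * F c r (j - 1)))"
    by (simp add: algebra_simps flip: \<open>_ = X\<close>)
  then have "C * (C * inverse Y + F c r (j - 1)) = X * (g * f)"
    using fg C by simp
  \<comment> \<open>Cancelling \<open>C\<close> and then the common summand
    \<open>F c r (j - 1)\<close> is the subtraction that the maximum would not allow.\<close>
  then have "C * inverse Y = F c (r - 1) j"
    using X C by simp
  then have "Y = C * inverse (F c (r - 1) j)"
    using C by (metis inverse_inverse_eq inverse_mult_distrib mult.left_commute
        mult.right_neutral right_inverse less_numeral_extra(3))
  then show ?case
    using Suc.IH[of j c] Suc.prems by (simp add: Y_def r_def I_def M_def e_def ac_simps)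
qed

end

section \<open>Tropicalisation\<close>

text \<open>Passing to exponential growth rates turns sums, products and parallel sums of positive reals
  into maxima, sums and minima.\<close>

definition growth :: "(nat \<Rightarrow> real) \<Rightarrow> real \<Rightarrow> bool" where
  "growth f \<alpha> \<longleftrightarrow> (\<forall>n. 0 < f n) \<and> (\<lambda>n. ln (f n) / real n) \<longlonglongrightarrow> \<alpha>"

lemma growth_pos: "growth f \<alpha> \<Longrightarrow> 0 < f n"
  by (simp add: growth_def)

lemma growth_unique: "growth f \<alpha> \<Longrightarrow> growth f \<beta> \<Longrightarrow> \<alpha> = \<beta>"
  using LIMSEQ_unique by (auto simp: growth_def)

lemma growth_exp: "growth (\<lambda>n. exp (real n * \<alpha>)) \<alpha>"
proof -
  have "(\<lambda>n. ln (exp (real n * \<alpha>)) / real n) \<longlonglongrightarrow> \<alpha>"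
    by (intro tendsto_eventually eventually_sequentiallyI[of 1]) simp
  then show ?thesis by (simp add: growth_def)
qed

lemma growth_1: "growth (\<lambda>_. 1) 0"
  by (simp add: growth_def)

lemma growth_mult:
  assumes "growth f \<alpha>" "growth g \<beta>" shows "growth (\<lambda>n. f n * g n) (\<alpha> + \<beta>)"
proof -
  have "ln (f n * g n) / real n = ln (f n) / real n + ln (g n) / real n" for n
    using growth_pos[OF assms(1), of n] growth_pos[OF assms(2), of n]
    by (simp add: ln_mult add_divide_distrib)
  then show ?thesis using assms by (auto simp: growth_def intro: tendsto_add)
qed

lemma growth_inverse:
  assumes "growth f \<alpha>" shows "growth (\<lambda>n. inverse (f n)) (- \<alpha>)"
proof -
  have "ln (inverse (f n)) / real n = - (ln (f n) / real n)" for n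
    using growth_pos[OF assms, of n] by (simp add: ln_inverse)
  then show ?thesis using assms tendsto_minus by (auto simp: growth_def)
qed

lemma growth_divide:
  assumes "growth f \<alpha>" "growth g \<beta>" shows "growth (\<lambda>n. f n / g n) (\<alpha> - \<beta>)"
  using growth_mult[OF assms(1) growth_inverse[OF assms(2)]] by (simp add: divide_inverse)

text \<open>The sum lies between the maximum and twice the maximum; the factor \<open>2\<close>
  costs \<open>ln 2 / n\<close>, which vanishes in the limit.\<close>

lemma growth_add:
  assumes f: "growth f \<alpha>" and g: "growth g \<beta>" shows "growth (\<lambda>n. f n + g n) (max \<alpha> \<beta>)"
proof -
  define m where "m = (\<lambda>n. max (ln (f n) / real n) (ln (g n) / real n))"
  have m: "m \<longlonglongrightarrow> max \<alpha> \<beta>"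
    using f g unfolding m_def growth_def by (intro tendsto_max) auto
  have "(\<lambda>n. m n + ln 2 / real n) \<longlonglongrightarrow> max \<alpha> \<beta> + 0"
    by (intro tendsto_add m lim_const_over_n)
  then have m': "(\<lambda>n. m n + ln 2 / real n) \<longlonglongrightarrow> max \<alpha> \<beta>"
    by simp
  have lower: "m n \<le> ln (f n + g n) / real n" for n
    using growth_pos[OF f, of n] growth_pos[OF g, of n]
    by (auto simp: m_def intro!: divide_right_mono)
  have upper: "ln (f n + g n) / real n \<le> m n + ln 2 / real n" for n
  proof -
    have pos: "0 < f n" "0 < g n" using growth_pos f g by auto
    have "ln (f n + g n) \<le> ln (2 * max (f n) (g n))" using pos by (subst ln_le_cancel_iff) auto
    also have "\<dots> = ln 2 + max (ln (f n)) (ln (g n))" using pos by (auto simp: ln_mult max_def)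
    finally have "ln (f n + g n) / real n \<le> (ln 2 + max (ln (f n)) (ln (g n))) / real n"
      by (rule divide_right_mono) simp
    also have "\<dots> = m n + ln 2 / real n"
      by (auto simp: m_def add_divide_distrib max_def divide_right_mono dest: divide_right_mono_neg)
        (auto simp: divide_le_cancel)
    finally show ?thesis .
  qed
  have "(\<lambda>n. ln (f n + g n) / real n) \<longlonglongrightarrow> max \<alpha> \<beta>"
    by (rule tendsto_sandwich[OF _ _ m m']) (intro always_eventually allI lower upper)+
  then show ?thesis using f g by (simp add: growth_def add_pos_pos)
qed

section \<open>The birational lift of the tropical dynamics\<close>

text \<open>Since \<open>inverse 0 = 0\<close>, the boundary value \<open>0\<close> plays two roles: below the rectangle it drops out of
  a sum of labels, and above the rectangle it stands for infinity and drops out of a sum of inverses.\<close>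

definition extend :: "nat \<Rightarrow> nat \<Rightarrow> real \<Rightarrow> (nat \<Rightarrow> nat \<Rightarrow> real) \<Rightarrow> nat \<Rightarrow> nat \<Rightarrow> real" where
  "extend p q C f i j =
     (if j = 0 then 0 else if i = 0 then (if j = 1 then 1 else 0)
      else if p < i then (if j = q then C else 0) else if q < j then 0 else f i j)"

text \<open>A whole promotion step. Toggles run in increasing order of \<open>j - i\<close>, so the
  left and upper neighbours are already updated while the lower and right ones are old; the
  recursion follows this order.\<close>

function birational_step ::
    "nat \<Rightarrow> nat \<Rightarrow> real \<Rightarrow> (nat \<Rightarrow> nat \<Rightarrow> real) \<Rightarrow> nat \<Rightarrow> nat \<Rightarrow> real" where
  "birational_step p q C f i j =
     (if 1 \<le> i \<and> i \<le> p \<and> 1 \<le> j \<and> j \<le> q then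
        (birational_step p q C f i (j - 1) + f (i - 1) j) /
        (f i j * (inverse (birational_step p q C f (Suc i) j) + inverse (f i (Suc j))))
      else extend p q C f i j)"
  by auto
termination by (relation "measure (\<lambda>(p, q, C, f, i, j). (Suc p - i) + j)") auto

declare birational_step.simps [simp del]

lemma birational_step_boundary:
  "\<not> (1 \<le> i \<and> i \<le> p \<and> 1 \<le> j \<and> j \<le> q) \<Longrightarrow> birational_step p q C f i j = extend p q C g i j"
  by (subst birational_step.simps) (auto simp: extend_def)

text \<open>Row \<open>i\<close> of the rectangle is row \<open>p + 1 - i\<close> of the tableau, and \<open>L t i j\<close> will be the number of
  entries at most \<open>p + j - i\<close> in that row of the \<open>t\<close>-th promotion; all other counts are forced to
  be \<open>0\<close> or \<open>b\<close>.\<close>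

locale tropical_promotion =
  fixes p q :: nat and b :: real and L :: "nat \<Rightarrow> nat \<Rightarrow> nat \<Rightarrow> real"
  assumes p1: "1 \<le> p"
    and range: "\<And>t i j. 0 \<le> L t i j \<and> L t i j \<le> b"
    and left: "\<And>t i. \<lbrakk>1 \<le> i; i \<le> p\<rbrakk> \<Longrightarrow> L t i 0 = 0"
    and bottom: "\<And>t j. \<lbrakk>1 \<le> j; j \<le> q\<rbrakk> \<Longrightarrow> L t 0 j = 0"
    and right: "\<And>t i. \<lbrakk>1 \<le> i; i \<le> p\<rbrakk> \<Longrightarrow> L t i (Suc q) = b"
    and top: "\<And>t j. \<lbrakk>1 \<le> j; j \<le> q\<rbrakk> \<Longrightarrow> L t (Suc p) j = b"
    and toggle: "\<And>t i j. \<lbrakk>1 \<le> i; i \<le> p; 1 \<le> j; j \<le> q\<rbrakk> \<Longrightarrow>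
      L (Suc t) i j + L t i j =
        min (L (Suc t) (Suc i) j) (L t i (Suc j)) + max (L (Suc t) i (j - 1)) (L t (i - 1) j)"
begin

definition f :: "nat \<Rightarrow> nat \<Rightarrow> nat \<Rightarrow> nat \<Rightarrow> real" where
  "f n t = (birational_step p q (exp (real n * b)) ^^ t)
     (extend p q (exp (real n * b)) (\<lambda>i j. exp (real n * L 0 i j)))"

lemma f_boundary:
  "\<not> (1 \<le> i \<and> i \<le> p \<and> 1 \<le> j \<and> j \<le> q) \<Longrightarrow> f n t i j = extend p q (exp (real n * b)) (\<lambda>_ _. 0) i j"
  by (cases t) (auto simp: f_def birational_step_boundary[where g = "\<lambda>_ _. 0"], auto simp: extend_def)

lemma f_Suc:
  "\<lbrakk>1 \<le> i; i \<le> p; 1 \<le> j; j \<le> q\<rbrakk> \<Longrightarrow> f n (Suc t) i j = (f n (Suc t) i (j - 1) + f n t (i - 1) j) /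
     (f n t i j * (inverse (f n (Suc t) (Suc i) j) + inverse (f n t i (Suc j))))"
  unfolding f_def funpow.simps o_def by (subst birational_step.simps) simp

text \<open>A label \<open>0\<close> has no growth rate, so the boundary is treated separately.
  There the tropical label is \<open>0\<close>, the least value, and drops out of the maximum as the
  real label does out of the sum.\<close>

lemma growth_lower:
  assumes ij: "1 \<le> i" "i \<le> p" "1 \<le> j" "j \<le> q"
    and l: "2 \<le> j \<Longrightarrow> growth (\<lambda>n. f n t i (j - 1)) (L t i (j - 1))"
    and r: "2 \<le> i \<Longrightarrow> growth (\<lambda>n. f n s (i - 1) j) (L s (i - 1) j)"
  shows "growth (\<lambda>n. f n t i (j - 1) + f n s (i - 1) j) (max (L t i (j - 1)) (L s (i - 1) j))"
proof -
  have l0: "f n t i 0 = 0" for n t i by (simp add: f_boundary extend_def)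
  have r0: "f n s 0 j = (if j = 1 then 1 else 0)" if "1 \<le> j" for n s j
    using that by (simp add: f_boundary extend_def)
  consider "i = 1" "j = 1" | "i = 1" "2 \<le> j" | "2 \<le> i" "j = 1" | "2 \<le> i" "2 \<le> j" using ij by linarith
  then show ?thesis
  proof cases
    case 1 then show ?thesis using growth_1 left bottom ij by (simp add: l0 r0)
  next
    case 2 then show ?thesis using l range[of t i "j - 1"] bottom[of j] ij by (simp add: r0 max_absorb1)
  next
    case 3 then show ?thesis using r range[of s "i - 1" j] left[of i] ij by (simp add: l0 max_absorb2)
  next
    case 4 then show ?thesis using growth_add l r by blast
  qed
qed

lemma growth_upper:
  assumes ij: "1 \<le> i" "i \<le> p" "1 \<le> j" "j \<le> q"
    and l: "Suc i \<le> p \<Longrightarrow> growth (\<lambda>n. f n t (Suc i) j) (L t (Suc i) j)"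
    and r: "Suc j \<le> q \<Longrightarrow> growth (\<lambda>n. f n s i (Suc j)) (L s i (Suc j))"
  shows "growth (\<lambda>n. inverse (f n t (Suc i) j) + inverse (f n s i (Suc j)))
    (- min (L t (Suc i) j) (L s i (Suc j)))"
proof -
  have l0: "f n t (Suc p) j = (if j = q then exp (real n * b) else 0)" if "1 \<le> j" for n t j
    using that by (simp add: f_boundary extend_def)
  have r0: "f n s i (Suc q) = 0" if "1 \<le> i" "i \<le> p" for n s i
    using that by (simp add: f_boundary extend_def)
  consider "i = p" "j = q" | "i = p" "Suc j \<le> q" | "Suc i \<le> p" "j = q" | "Suc i \<le> p" "Suc j \<le> q"
    using ij by linarith
  then show ?thesis
  proof cases
    case 1
    then show ?thesis using growth_inverse[OF growth_exp[of b]] top[of q t] right[of p s] ij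
      by (simp add: l0 r0)
  next
    case 2
    then show ?thesis using growth_inverse[OF r] range[of s i "Suc j"] top[of j t] ij
      by (simp add: l0 min_absorb2)
  next
    case 3
    then show ?thesis using growth_inverse[OF l] range[of t "Suc i" j] right[of i s] ij
      by (simp add: r0 min_absorb1)
  next
    case 4
    then show ?thesis using growth_add[OF growth_inverse growth_inverse, OF l r]
      by (simp add: minus_min_eq_max)
  qed
qed

text \<open>The outer induction runs over time, the inner one over the order in which
  \<open>birational_step\<close> updates the labels.\<close>

lemma growth_f: "\<lbrakk>1 \<le> i; i \<le> p; 1 \<le> j; j \<le> q\<rbrakk> \<Longrightarrow> growth (\<lambda>n. f n t i j) (L t i j)"
proof (induction t arbitrary: i j)
  case 0
  then show ?case using growth_exp[of "L 0 i j"] by (simp add: f_def extend_def)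
next
  case (Suc t)
  note IH = Suc.IH
  show ?case using Suc.prems
  proof (induction "(p - i) + j" arbitrary: i j rule: less_induct)
    case less
    have "growth (\<lambda>n. f n (Suc t) i j) (max (L (Suc t) i (j - 1)) (L t (i - 1) j) -
        (L t i j + - min (L (Suc t) (Suc i) j) (L t i (Suc j))))"
      unfolding f_Suc[OF less.prems]
      by (intro growth_divide growth_mult growth_lower growth_upper IH less.hyps) (use less.prems in auto)
    also have "max (L (Suc t) i (j - 1)) (L t (i - 1) j) -
        (L t i j + - min (L (Suc t) (Suc i) j) (L t i (Suc j))) = L (Suc t) i j"
      using toggle[OF less.prems, of t] by linarith
    finally show ?case .
  qed
qed

text \<open>Reciprocity holds for the lift at every scale \<open>n\<close>; its right-hand side
  grows at rate \<open>b\<close>, and growth rates are unique.\<close>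

lemma tropical_reciprocity:
  assumes ij: "1 \<le> i" "i \<le> p" "1 \<le> j" "j \<le> q"
  shows "L (t + (p - i) + j) (p + 1 - i) (q + 1 - j) + L t i j = b"
proof -
  have recip: "f n (t + (p - i) + j) (p + 1 - i) (q + 1 - j) * f n t i j = exp (real n * b)" for n
  proof -
    have f_pos: "0 < f n t i j" if "1 \<le> i" "i \<le> p" "1 \<le> j" "j \<le> q" for t i j
      using growth_pos[OF growth_f[OF that]] by simp
    \<comment> \<open>Reading column \<open>j\<close> at time \<open>c - j\<close> puts both lower
      covers at time \<open>c\<close> and both upper covers at time \<open>Suc c\<close>, as a
      rowmotion toggle requires.\<close>
    interpret birational_rowmotion p q "exp (real n * b)" "\<lambda>c i j. f n (c - j) i j"
    proof
      fix c i j :: nat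
      assume ij: "1 \<le> i" "i \<le> p" "1 \<le> j" "j \<le> q" "j \<le> c"
      show "f n (Suc c - j) i j * f n (c - j) i j *
          (inverse (f n (Suc c - j) (Suc i) j) + inverse (f n (Suc c - Suc j) i (Suc j))) =
          f n (c - j) (i - 1) j + f n (c - (j - 1)) i (j - 1)"
      proof -
        define s where "s = c - j"
        have s: "Suc c - j = Suc s" "c - (j - 1) = Suc s" using ij by (auto simp: s_def)
        have "0 < inverse (f n (Suc s) (Suc i) j) + inverse (f n s i (Suc j))"
          by (rule growth_pos[OF growth_upper]) (use ij growth_f in auto)
        then show ?thesis
          using f_Suc[OF ij(1-4), of n s] f_pos[OF ij(1-4), of s] unfolding s diff_Suc_Suc s_def[symmetric]
          by (simp add: mult.assoc)
      qed
    qed (use f_pos p1 in \<open>auto simp: f_boundary extend_def\<close>)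
    define I where "I = p - i"
    have I: "p - I = i" "I \<le> p" "p + 1 - i = I + 1" using ij by (auto simp: I_def)
    have "t + j + (q - j) + (I + 1) - (q + 1 - j) = t + I + j" using ij by simp
    then have "f n (t + I + j) (I + 1) (q + 1 - j) = exp (real n * b) * inverse (f n t i j)"
      using reciprocity[of I j "t + j"] I ij by (simp add: add.assoc)
    then show ?thesis using f_pos[OF ij, of t] unfolding I I_def[symmetric] by simp
  qed
  have "growth (\<lambda>n. f n (t + (p - i) + j) (p + 1 - i) (q + 1 - j) * f n t i j)
      (L (t + (p - i) + j) (p + 1 - i) (q + 1 - j) + L t i j)"
    by (intro growth_mult growth_f) (use ij in auto)
  then show ?thesis using growth_unique[OF growth_exp] unfolding recip by metis
qed

end

section \<open>Bender-Knuth involutions as toggles of entry counts\<close>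

text \<open>The counts form the Gelfand-Tsetlin pattern of the tableau. Row \<open>0\<close> counts
  as filled with entries below every bound, rows after \<open>a\<close> with entries above every
  bound, so that toggles have one form in all rows.\<close>

definition entry_count :: "nat \<Rightarrow> nat \<Rightarrow> tableau \<Rightarrow> nat \<Rightarrow> nat \<Rightarrow> nat" where
  "entry_count a b T x e =
     (if x = 0 then b else if a < x then 0 else card {j \<in> {1..b}. T x j \<le> e})"

lemma SSYT_entry:
  "T \<in> SSYT k a b \<Longrightarrow> 1 \<le> x \<Longrightarrow> x \<le> a \<Longrightarrow> 1 \<le> j \<Longrightarrow> j \<le> b \<Longrightarrow> 1 \<le> T x j \<and> T x j \<le> k"
  by (force simp: SSYT_def)

lemma SSYT_row:
  "T \<in> SSYT k a b \<Longrightarrow> 1 \<le> x \<Longrightarrow> x \<le> a \<Longrightarrow> 1 \<le> j \<Longrightarrow> j \<le> j' \<Longrightarrow> j' \<le> b \<Longrightarrow> T x j \<le> T x j'"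
  by (cases "j = j'") (force simp: SSYT_def)+

lemma SSYT_col:
  "T \<in> SSYT k a b \<Longrightarrow> 1 \<le> x \<Longrightarrow> x < x' \<Longrightarrow> x' \<le> a \<Longrightarrow> 1 \<le> j \<Longrightarrow> j \<le> b \<Longrightarrow> T x j < T x' j"
  by (force simp: SSYT_def)

lemma SSYT_outside: "T \<in> SSYT k a b \<Longrightarrow> x \<notin> {1..a} \<or> j \<notin> {1..b} \<Longrightarrow> T x j = 0"
  by (force simp: SSYT_def)

lemma card_down_closed:
  fixes b :: nat
  assumes "\<And>j j'. \<lbrakk>1 \<le> j; j \<le> j'; j' \<le> b; P j'\<rbrakk> \<Longrightarrow> P j" and "1 \<le> j" "j \<le> b"
  shows "P j \<longleftrightarrow> j \<le> card {j \<in> {1..b}. P j}"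
proof
  assume "P j"
  then have "{1..j} \<subseteq> {j \<in> {1..b}. P j}" using assms by force
  then have "card {1..j} \<le> card {j \<in> {1..b}. P j}" by (intro card_mono) auto
  then show "j \<le> card {j \<in> {1..b}. P j}" by simp
next
  assume *: "j \<le> card {j \<in> {1..b}. P j}"
  show "P j"
  proof (rule ccontr)
    assume "\<not> P j"
    then have "{j \<in> {1..b}. P j} \<subseteq> {1..<j}" using assms by (force simp: not_le[symmetric])
    then have "card {j \<in> {1..b}. P j} \<le> card {1..<j}" by (intro card_mono) auto
    then show False using * assms by simp
  qed
qed

text \<open>Rows increase weakly, so the entries at most \<open>e\<close> fill an initial segment;
  hence the counts determine the tableau.\<close>

lemma entry_le_iff:
  assumes "T \<in> SSYT k a b" "1 \<le> x" "x \<le> a" "1 \<le> j" "j \<le> b"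
  shows "T x j \<le> e \<longleftrightarrow> j \<le> entry_count a b T x e"
proof -
  have "T x j \<le> e" if "1 \<le> j" "j \<le> j'" "j' \<le> b" "T x j' \<le> e" for j j'
    using SSYT_row[OF assms(1-3) that(1-3)] that(4) by simp
  from card_down_closed[of b "\<lambda>j. T x j \<le> e", OF this assms(4,5)] show ?thesis
    using assms(2,3) by (simp add: entry_count_def)
qed

lemma entry_count_le: "entry_count a b T x e \<le> b"
proof -
  have "card {j \<in> {1..b}. T x j \<le> e} \<le> card {1..b}" by (rule card_mono) auto
  then show ?thesis by (simp add: entry_count_def)
qed

lemma entry_count_eqI:
  assumes "1 \<le> x" "x \<le> a" "n \<le> b" "\<And>j. 1 \<le> j \<Longrightarrow> j \<le> b \<Longrightarrow> T x j \<le> e \<longleftrightarrow> j \<le> n"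
  shows "entry_count a b T x e = n"
proof -
  have "{j \<in> {1..b}. T x j \<le> e} = {1..n}" using assms by force
  then show ?thesis using assms by (simp add: entry_count_def)
qed

lemma entry_count_mono: "e \<le> e' \<Longrightarrow> entry_count a b T x e \<le> entry_count a b T x e'"
  by (auto simp: entry_count_def intro!: card_mono)

lemma entry_count_strict:
  assumes "T \<in> SSYT k a b"
  shows "entry_count a b T (Suc x) (Suc e) \<le> entry_count a b T x e"
proof (cases "1 \<le> x \<and> Suc x \<le> a")
  case True
  have "{j \<in> {1..b}. T (Suc x) j \<le> Suc e} \<subseteq> {j \<in> {1..b}. T x j \<le> e}"
    using SSYT_col[OF assms, of x "Suc x"] True by force
  then show ?thesis using True by (auto simp: entry_count_def intro!: card_mono)
next
  case False
  then show ?thesis using entry_count_le[of a b T "Suc x" "Suc e"] by (auto simp: entry_count_def)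
qed

lemma entry_count_0:
  assumes "T \<in> SSYT k a b" "1 \<le> x" shows "entry_count a b T x 0 = 0"
proof -
  have "{j \<in> {1..b}. T x j \<le> 0} = {}" if "x \<le> a"
    using SSYT_entry[OF assms(1,2) that] by force
  then show ?thesis using assms(2) by (simp add: entry_count_def)
qed

lemma entry_count_full:
  assumes "T \<in> SSYT k a b" "x \<le> a" "k \<le> e" shows "entry_count a b T x e = b"
proof (cases "x = 0")
  case False
  then show ?thesis using assms SSYT_entry[OF assms(1), of x]
    by (intro entry_count_eqI) (auto intro: le_trans)
qed (simp add: entry_count_def)

lemma entry_count_eq_0:
  assumes "T \<in> SSYT k a b" "e < x" shows "entry_count a b T x e = 0"
  using assms(2)
proof (induction e arbitrary: x)
  case 0 then show ?case using entry_count_0[OF assms(1)] by simp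
next
  case (Suc e)
  then obtain y where "x = Suc y" "e < y" by (cases x) auto
  then show ?case using entry_count_strict[OF assms(1), of y e] Suc.IH[of y] by simp
qed

text \<open>Going down a column raises the bound by one per row, until in row \<open>a\<close> it is
  at least \<open>k\<close>.\<close>

lemma entry_count_eq_b:
  assumes "T \<in> SSYT k a b" "x \<le> a" "k + x \<le> a + e" shows "entry_count a b T x e = b"
  using assms(2,3)
proof (induction "a - x" arbitrary: x e)
  case 0 then show ?case using entry_count_full[OF assms(1)] by simp
next
  case (Suc n)
  have "entry_count a b T (Suc x) (Suc e) = b"
    using Suc.hyps(1)[of "Suc x" "Suc e"] Suc.hyps(2) Suc.prems by simp
  then show ?case using entry_count_strict[OF assms(1), of x e] entry_count_le[of a b T x e] by simp
qed

lemma SSYT_if_counts: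
  assumes le_iff: "\<And>x j e. \<lbrakk>1 \<le> x; x \<le> a; 1 \<le> j; j \<le> b\<rbrakk> \<Longrightarrow> T x j \<le> e \<longleftrightarrow> j \<le> n x e"
    and strict: "\<And>x e. \<lbrakk>1 \<le> x; x < a\<rbrakk> \<Longrightarrow> n (Suc x) (Suc e) \<le> n x e"
    and n0: "\<And>x. \<lbrakk>1 \<le> x; x \<le> a\<rbrakk> \<Longrightarrow> n x 0 = 0"
    and nk: "\<And>x. \<lbrakk>1 \<le> x; x \<le> a\<rbrakk> \<Longrightarrow> n x k = b"
    and outside: "\<And>x j. x \<notin> {1..a} \<or> j \<notin> {1..b} \<Longrightarrow> T x j = 0"
  shows "T \<in> SSYT k a b"
proof -
  have entry: "1 \<le> T x j \<and> T x j \<le> k" if "1 \<le> x" "x \<le> a" "1 \<le> j" "j \<le> b" for x j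
    using le_iff[OF that, of 0] le_iff[OF that, of k] n0 nk that by auto
  have row: "T x j \<le> T x j'" if "1 \<le> x" "x \<le> a" "1 \<le> j" "j < j'" "j' \<le> b" for x j j'
    using le_iff[of x j' "T x j'"] le_iff[of x j "T x j'"] that by auto
  have col1: "T x j < T (Suc x) j" if "1 \<le> x" "x < a" "1 \<le> j" "j \<le> b" for x j
  proof -
    have "Suc x \<le> a" using that by simp
    with entry[of "Suc x" j] that obtain e where e: "T (Suc x) j = Suc e"
      by (cases "T (Suc x) j") auto
    have "j \<le> n (Suc x) (Suc e)" using le_iff[of "Suc x" j "Suc e"] e that by simp
    then have "T x j \<le> e" using le_iff[of x j e] strict[of x e] that by simp
    then show ?thesis using e by simp
  qed
  have col: "T x j < T x' j" if "1 \<le> x" "x < x'" "x' \<le> a" "1 \<le> j" "j \<le> b" for x x' j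
    using that(2,3)
  proof (induction x')
    case (Suc x')
    then show ?case using col1[of x' j] that by (cases "x = x'") auto
  qed simp
  show ?thesis unfolding SSYT_def mem_Collect_eq
  proof (intro conjI ballI allI impI)
    fix x j assume "x \<in> {1..a}" "j \<in> {1..b}"
    then show "T x j \<in> {1..k}" using entry[of x j] by simp
  next
    fix x j j' assume "x \<in> {1..a}" "j \<in> {1..b}" "j' \<in> {1..b}" "j < j'"
    then show "T x j \<le> T x j'" using row[of x j j'] by simp
  next
    fix x x' j assume "x \<in> {1..a}" "x' \<in> {1..a}" "j \<in> {1..b}" "x < x'"
    then show "T x j < T x' j" using col[of x x' j] by simp
  next
    fix x j assume "x \<notin> {1..a} \<or> j \<notin> {1..b}"
    then show "T x j = 0" by (rule outside)
  qed
qed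

section \<open>A single Bender-Knuth involution\<close>

locale bender_knuth_step =
  fixes k a b i :: nat and T :: tableau
  assumes T: "T \<in> SSYT k a b" and i: "1 \<le> i" "i < k"
begin

abbreviation "n \<equiv> entry_count a b T"

text \<open>An \<open>i\<close> in a column up to \<open>low x\<close> has \<open>i + 1\<close>
  below it, and an \<open>i + 1\<close> in a column after \<open>high x\<close> has \<open>i\<close>
  above it. The free columns thus form the interval between, cut at \<open>n x i\<close>.\<close>

definition low :: "nat \<Rightarrow> nat" where
  "low x = max (n x (i - 1)) (n (x + 1) (i + 1))"

definition high :: "nat \<Rightarrow> nat" where
  "high x = min (n (x - 1) (i - 1)) (n x (i + 1))"

lemma low_le: "low x \<le> n x i"
  using entry_count_mono[of "i - 1" i a b T x] entry_count_strict[OF T, of x i] by (simp add: low_def)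

lemma high_ge: "1 \<le> x \<Longrightarrow> n x i \<le> high x"
  using entry_count_mono[of i "i + 1" a b T x] entry_count_strict[OF T, of "x - 1" "i - 1"] i
  by (simp add: high_def)

lemma entry_eq_iff:
  assumes "1 \<le> x" "x \<le> a" "1 \<le> j" "j \<le> b"
  shows "T x j = Suc e \<longleftrightarrow> n x e < j \<and> j \<le> n x (Suc e)"
  using entry_le_iff[OF T assms, of e] entry_le_iff[OF T assms, of "Suc e"] by linarith

lemma free_low_eq:
  assumes x: "1 \<le> x" "x \<le> a"
  shows "free_low a b i T x = {low x<..n x i}"
proof -
  have "j \<in> free_low a b i T x \<longleftrightarrow> j \<in> {low x<..n x i}" if "j \<in> {1..b}" for j
  proof -
    have j: "1 \<le> j" "j \<le> b" using that by auto
    show ?thesis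
    proof (cases "x = a")
      case True
      then show ?thesis using entry_eq_iff[OF x j, of "i - 1"] x j i
        by (auto simp: free_low_def low_def entry_count_def[of a b T "Suc a"])
    next
      case False
      then have "T x j < T (Suc x) j" using SSYT_col[OF T, of x "Suc x" j] x j by simp
      then show ?thesis
        using entry_eq_iff[OF x j, of "i - 1"] entry_le_iff[OF T _ _ j, of "Suc x" "Suc i"] x j i False
        by (auto simp: free_low_def low_def)
    qed
  qed
  moreover have "free_low a b i T x \<subseteq> {1..b}" "{low x<..n x i} \<subseteq> {1..b}"
    using entry_count_le[of a b T x i] by (auto simp: free_low_def)
  ultimately show ?thesis by blast
qed

lemma free_high_eq:
  assumes x: "1 \<le> x" "x \<le> a"
  shows "free_high a b i T x = {n x i<..high x}"
proof -
  have "j \<in> free_high a b i T x \<longleftrightarrow> j \<in> {n x i<..high x}" if "j \<in> {1..b}" for j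
  proof -
    have j: "1 \<le> j" "j \<le> b" using that by auto
    show ?thesis
    proof (cases "x = 1")
      case True
      then show ?thesis using entry_eq_iff[OF x j, of i] x j i
        by (auto simp: free_high_def high_def entry_count_def[of a b T 0])
    next
      case False
      then obtain y where y: "x = Suc y" "1 \<le> y" using x by (cases x) auto
      then have "T y j < T x j" using SSYT_col[OF T, of y x j] x j by simp
      then show ?thesis
        using entry_eq_iff[OF x j, of i] entry_le_iff[OF T _ _ j, of y "i - 1"] x j i y
        by (auto simp: free_high_def high_def)
    qed
  qed
  moreover have "high x \<le> b" using entry_count_le[of a b T x "i + 1"] by (simp add: high_def min.coboundedI2)
  then have "{n x i<..high x} \<subseteq> {1..b}" by auto
  moreover have "free_high a b i T x \<subseteq> {1..b}" by (auto simp: free_high_def)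
  ultimately show ?thesis by blast
qed

text \<open>Exchanging the numbers of free \<open>i\<close> and free \<open>i + 1\<close> reflects
  the cut \<open>n x i\<close> within the interval of free columns.\<close>

lemma bender_knuth_entry:
  assumes x: "1 \<le> x" "x \<le> a"
  shows "bender_knuth a b i T x j =
    (if low x < j \<and> j \<le> high x then (if j \<le> low x + high x - n x i then i else i + 1) else T x j)"
proof -
  have F: "free_low a b i T x \<union> free_high a b i T x = {low x<..high x}"
    using low_le[of x] high_ge[OF x(1)] unfolding free_low_eq[OF x] free_high_eq[OF x] by auto
  have "{j' \<in> {low x<..high x}. j' < j} = {low x<..<j}" if "j \<le> high x" for j
    using that by auto
  then show ?thesis
    using low_le[of x] high_ge[OF x(1)]
    unfolding bender_knuth_def Let_def F unfolding free_high_eq[OF x] by auto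
qed

definition n' :: "nat \<Rightarrow> nat \<Rightarrow> nat" where
  "n' x e = (if e = i \<and> 1 \<le> x \<and> x \<le> a then low x + high x - n x i else n x e)"

lemma bender_knuth_le_iff:
  assumes "1 \<le> x" "x \<le> a" "1 \<le> j" "j \<le> b"
  shows "bender_knuth a b i T x j \<le> e \<longleftrightarrow> j \<le> n' x e"
proof -
  have le: "low x \<le> n x i" "n x i \<le> high x" using low_le high_ge assms by auto
  have low: "n x (i - 1) \<le> low x" and high: "high x \<le> n x (i + 1)" by (auto simp: low_def high_def)
  have below: "n x e \<le> n x (i - 1)" if "e < i" using that by (intro entry_count_mono) auto
  have above: "n x (i + 1) \<le> n x e" if "i < e" using that by (intro entry_count_mono) auto
  consider "e < i" | "e = i" | "e > i" by linarith
  then show ?thesis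
    using entry_le_iff[OF T assms, of e] le low high below above assms
    by cases (auto simp: bender_knuth_entry n'_def)
qed

lemma bender_knuth_SSYT: "bender_knuth a b i T \<in> SSYT k a b"
proof (rule SSYT_if_counts[where n = n'])
  show "n' (Suc x) (Suc e) \<le> n' x e" if "1 \<le> x" "x < a" for x e
  proof -
    have "low (Suc x) + high (Suc x) - n (Suc x) i \<le> n x (i - 1)"
      using low_le[of "Suc x"] by (simp add: high_def)
    moreover have "n (Suc x) (Suc i) \<le> low x + high x - n x i"
      using high_ge[of x] that by (simp add: low_def)
    moreover have "n (Suc x) (Suc e) \<le> n x e" by (rule entry_count_strict[OF T])
    ultimately show ?thesis using that i by (auto simp: n'_def)
  qed
  show "n' x 0 = 0" if "1 \<le> x" "x \<le> a" for x
    using that i entry_count_0[OF T] by (simp add: n'_def)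
  show "n' x k = b" if "1 \<le> x" "x \<le> a" for x
    using that i entry_count_full[OF T] by (simp add: n'_def)
  show "bender_knuth a b i T x j = 0" if "x \<notin> {1..a} \<or> j \<notin> {1..b}" for x j
    using that SSYT_outside[OF T that]
    by (auto simp: bender_knuth_def Let_def free_low_def free_high_def)
qed (use bender_knuth_le_iff in auto)

lemma entry_count_bender_knuth: "entry_count a b (bender_knuth a b i T) x e = n' x e"
proof (cases "1 \<le> x \<and> x \<le> a")
  case True
  have "n' x e \<le> b"
    using entry_count_le[of a b T x e] entry_count_le[of a b T x "i + 1"] low_le[of x]
    by (auto simp: n'_def high_def)
  then show ?thesis using True bender_knuth_le_iff by (intro entry_count_eqI) auto
next
  case False
  then show ?thesis by (auto simp: n'_def entry_count_def)
qed

end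

text \<open>When the involution with index \<open>e\<close> acts, the counts for
  \<open>e - 1\<close> are already final and those for \<open>e + 1\<close> still original; later
  involutions leave the counts for \<open>e\<close> alone. Hence the mixture of \<open>P\<close> and
  \<open>T\<close>.\<close>

lemma promotion_fold:
  assumes T: "T \<in> SSYT k a b" and r: "r < k"
  defines "P \<equiv> fold (bender_knuth a b) [1..<Suc r] T"
  shows "P \<in> SSYT k a b"
    and "\<And>x e. r < e \<or> e = 0 \<Longrightarrow> entry_count a b P x e = entry_count a b T x e"
    and "\<And>x e. \<lbrakk>1 \<le> x; x \<le> a; 1 \<le> e; e \<le> r\<rbrakk> \<Longrightarrow>
      entry_count a b P x e + entry_count a b T x e =
        min (entry_count a b P (x - 1) (e - 1)) (entry_count a b T x (e + 1))
        + max (entry_count a b P x (e - 1)) (entry_count a b T (x + 1) (e + 1))"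
  unfolding P_def using r
proof (induction r)
  case 0
  {
    case 1 then show ?case using T by simp
  next
    case 2 then show ?case by simp
  next
    case 3 then show ?case by simp
  }
next
  case (Suc r)
  define Q where "Q = fold (bender_knuth a b) [1..<Suc r] T"
  have fold_Suc: "fold (bender_knuth a b) [1..<Suc (Suc r)] T = bender_knuth a b (Suc r) Q"
    by (simp add: Q_def)
  {
    case 1
    then have "bender_knuth_step k a b (Suc r) Q"
      using Suc(1) by unfold_locales (auto simp: Q_def)
    then show ?case unfolding fold_Suc by (rule bender_knuth_step.bender_knuth_SSYT)
  next
    case 2
    then have step: "bender_knuth_step k a b (Suc r) Q"
      using Suc(1) by unfold_locales (auto simp: Q_def)
    have "entry_count a b Q x e = entry_count a b T x e"
      using Suc(2)[of e x] 2 unfolding Q_def by linarith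
    then show ?case
      using 2 unfolding fold_Suc bender_knuth_step.entry_count_bender_knuth[OF step]
        bender_knuth_step.n'_def[OF step] by auto
  next
    case 3
    then have step: "bender_knuth_step k a b (Suc r) Q"
      using Suc(1) by unfold_locales (auto simp: Q_def)
    note cnt = bender_knuth_step.entry_count_bender_knuth[OF step]
      bender_knuth_step.n'_def[OF step] bender_knuth_step.low_def[OF step]
      bender_knuth_step.high_def[OF step]
    have same: "entry_count a b Q y e' = entry_count a b T y e'" if "r < e'" for y e'
      using Suc(2)[of e' y] 3 that by (simp add: Q_def)
    show ?case
    proof (cases "e = Suc r")
      case True
      have "entry_count a b Q x e \<le>
          bender_knuth_step.low a b (Suc r) Q x + bender_knuth_step.high a b (Suc r) Q x"
        using bender_knuth_step.high_ge[OF step] 3 True by (simp add: trans_le_add2)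
      then show ?thesis using True 3 unfolding fold_Suc by (simp add: cnt same)
    next
      case False
      have "e - 1 \<noteq> Suc r" using 3 by auto
      then show ?thesis using Suc(3)[folded Q_def, of x e] 3 False unfolding fold_Suc by (simp add: cnt)
    qed
  }
qed

section \<open>Orbits of promotion\<close>

lemma promotion_entry_count:
  assumes "T \<in> SSYT k a b" "1 \<le> k"
  shows "promotion k a b T \<in> SSYT k a b"
    and "\<And>x e. \<lbrakk>1 \<le> x; x \<le> a; 1 \<le> e; e < k\<rbrakk> \<Longrightarrow>
      entry_count a b (promotion k a b T) x e + entry_count a b T x e =
        min (entry_count a b (promotion k a b T) (x - 1) (e - 1)) (entry_count a b T x (e + 1))
        + max (entry_count a b (promotion k a b T) x (e - 1)) (entry_count a b T (x + 1) (e + 1))"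
proof -
  have P: "promotion k a b T = fold (bender_knuth a b) [1..<Suc (k - 1)] T"
    using assms(2) by (simp add: promotion_def)
  show "promotion k a b T \<in> SSYT k a b"
    unfolding P by (rule promotion_fold(1)) (use assms in auto)
  fix x e assume "1 \<le> x" "x \<le> a" "1 \<le> e" "e < k"
  then show "entry_count a b (promotion k a b T) x e + entry_count a b T x e =
        min (entry_count a b (promotion k a b T) (x - 1) (e - 1)) (entry_count a b T x (e + 1))
        + max (entry_count a b (promotion k a b T) x (e - 1)) (entry_count a b T (x + 1) (e + 1))"
    unfolding P by (intro promotion_fold(3)[OF assms(1)]) (use assms in auto)
qed

locale promotion_orbit =
  fixes k a b :: nat and T :: tableau
  assumes pos: "1 \<le> k" "1 \<le> a" "1 \<le> b" and T: "T \<in> SSYT k a b"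
begin

definition N :: "nat \<Rightarrow> nat \<Rightarrow> nat \<Rightarrow> nat" where
  "N t = entry_count a b ((promotion k a b ^^ t) T)"

lemma orbit_SSYT: "(promotion k a b ^^ t) T \<in> SSYT k a b"
  by (induction t) (use T promotion_entry_count(1) pos in auto)

lemma rows_le: "a \<le> k"
proof (rule ccontr)
  assume "\<not> a \<le> k"
  then have "N 0 a k = 0" unfolding N_def by (intro entry_count_eq_0[OF orbit_SSYT]) simp
  moreover have "N 0 a k = b" unfolding N_def by (intro entry_count_full[OF orbit_SSYT]) auto
  ultimately show False using pos by simp
qed

lemma N_toggle:
  assumes "1 \<le> x" "x \<le> a" "1 \<le> e" "e < k"
  shows "N (Suc t) x e + N t x e =
    min (N (Suc t) (x - 1) (e - 1)) (N t x (e + 1)) + max (N (Suc t) x (e - 1)) (N t (x + 1) (e + 1))"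
  using promotion_entry_count(2)[OF orbit_SSYT pos(1) assms] by (simp add: N_def)

text \<open>Bounds \<open>e\<close> outside a band of width \<open>k - a\<close> force both counts
  to be \<open>0\<close> or \<open>b\<close>; inside it the claim is tropical reciprocity.\<close>

lemma N_complement:
  assumes x: "1 \<le> x" "x \<le> a" and e: "e \<le> k"
  shows "N (t + e) (a + 1 - x) (k - e) + N t x e = b"
proof -
  consider "e < x" | "x + (k - a) \<le> e" | "x \<le> e" "e < x + (k - a)" by linarith
  then show ?thesis
  proof cases
    case 1
    then have "N t x e = 0" unfolding N_def by (rule entry_count_eq_0[OF orbit_SSYT])
    moreover have "N (t + e) (a + 1 - x) (k - e) = b"
      unfolding N_def by (rule entry_count_eq_b[OF orbit_SSYT]) (use 1 x e rows_le in auto)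
    ultimately show ?thesis by simp
  next
    case 2
    then have "N t x e = b"
      unfolding N_def using x rows_le by (intro entry_count_eq_b[OF orbit_SSYT]) auto
    moreover have "N (t + e) (a + 1 - x) (k - e) = 0"
      unfolding N_def by (rule entry_count_eq_0[OF orbit_SSYT]) (use 2 x e rows_le in auto)
    ultimately show ?thesis by simp
  next
    case 3
    define L where "L = (\<lambda>t i j. real (N t (a + 1 - i) (a + j - i)))"
    interpret tropical_promotion a "k - a" "real b" L
    proof
      show "0 \<le> L t i j \<and> L t i j \<le> real b" for t i j
        using entry_count_le by (simp add: L_def N_def)
      show "L t i 0 = 0" if "1 \<le> i" "i \<le> a" for t i
        using that entry_count_eq_0[OF orbit_SSYT] by (simp add: L_def N_def)
      show "L t 0 j = 0" for t j
        by (simp add: L_def N_def entry_count_def)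
      show "L t i (Suc (k - a)) = real b" if "1 \<le> i" "i \<le> a" for t i
        using that rows_le entry_count_eq_b[OF orbit_SSYT] by (simp add: L_def N_def)
      show "L t (Suc a) j = real b" for t j
        by (simp add: L_def N_def entry_count_def)
      fix t i j :: nat
      assume ij: "1 \<le> i" "i \<le> a" "1 \<le> j" "j \<le> k - a"
      define y d where "y = a + 1 - i" and "d = a + j - i"
      have y: "1 \<le> y" "y \<le> a" "1 \<le> d" "d < k"
        and eqs: "a + 1 - Suc i = y - 1" "a + j - Suc i = d - 1" "a + Suc j - i = d + 1"
          "a + (j - 1) - i = d - 1" "a + 1 - (i - 1) = y + 1" "a + j - (i - 1) = d + 1"
        using ij rows_le by (auto simp: y_def d_def)
      show "L (Suc t) i j + L t i j =
          min (L (Suc t) (Suc i) j) (L t i (Suc j)) + max (L (Suc t) i (j - 1)) (L t (i - 1) j)"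
        using N_toggle[OF y, of t] unfolding L_def eqs y_def[symmetric] d_def[symmetric]
        by (metis of_nat_add of_nat_max of_nat_min)
    qed (use pos in auto)
    \<comment> \<open>The rectangle position of row \<open>x\<close> and bound \<open>e\<close>; the
      inequalities of this case say that \<open>1 \<le> j\<close> and
      \<open>j \<le> k - a\<close>.\<close>
    define i j where "i = a + 1 - x" and "j = e + 1 - x"
    have "L (t + (a - i) + j) (a + 1 - i) (k - a + 1 - j) + L t i j = real b"
      by (rule tropical_reciprocity) (use 3 x in \<open>auto simp: i_def j_def\<close>)
    moreover have "t + (a - i) + j = t + e" "a + 1 - (a + 1 - i) = i"
      "a + (k - a + 1 - j) - (a + 1 - i) = k - e"
      "a + 1 - i = x" "a + j - i = e"
      using 3 x e rows_le by (auto simp: i_def j_def)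
    ultimately have "real (N (t + e) i (k - e)) + real (N t x e) = real b"
      unfolding L_def by simp
    then show ?thesis unfolding i_def by linarith
  qed
qed

text \<open>Complementing twice, with lags \<open>e\<close> and \<open>k - e\<close>, returns to the
  same row and bound after \<open>k\<close> steps.\<close>

lemma N_periodic:
  assumes "1 \<le> x" "x \<le> a" "e \<le> k" shows "N (t + k) x e = N t x e"
proof -
  have "1 \<le> a + 1 - x" "a + 1 - x \<le> a" using assms by auto
  from N_complement[OF this, of "k - e" "t + e"] show ?thesis
    using N_complement[OF assms, of t] assms by simp
qed

section \<open>From counts to multisets\<close>

lemma card_gt:
  assumes "1 \<le> x" "x \<le> a"
  shows "card {j \<in> {1..b}. int ((promotion k a b ^^ t) T x j) > d} =
    (if d < 0 then b else b - N t x (nat d))"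
proof -
  let ?S = "\<lambda>P. {j \<in> {1..b}. P ((promotion k a b ^^ t) T x j)}"
  show ?thesis
  proof (cases "d < 0")
    case True
    then have "?S (\<lambda>m. int m > d) = {1..b}" by auto
    then show ?thesis using True by simp
  next
    case False
    then have "?S (\<lambda>m. int m > d) = {1..b} - ?S (\<lambda>m. m \<le> nat d)" by auto
    then have "card (?S (\<lambda>m. int m > d)) = card ({1..b} - ?S (\<lambda>m. m \<le> nat d))"
      by (rule arg_cong)
    also have "\<dots> = card {1..b} - card (?S (\<lambda>m. m \<le> nat d))"
      by (rule card_Diff_subset) auto
    finally show ?thesis using False assms by (simp add: N_def entry_count_def)
  qed
qed

end

text \<open>Shifting once more trades the value at \<open>0\<close> for the value at
  \<open>k\<close>, and periodicity makes these equal.\<close>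

lemma image_mset_shift_periodic:
  fixes g :: "nat \<Rightarrow> 'a"
  assumes "\<And>t. g (t + k) = g t"
  shows "image_mset (\<lambda>t. g (t + s)) (mset_set {0..<k}) = image_mset g (mset_set {0..<k})"
proof (induction s)
  case (Suc s)
  define h where "h = (\<lambda>t. g (t + s))"
  have per: "h k = h 0" using assms[of s] by (simp add: h_def add.commute)
  have "add_mset (h 0) (image_mset (\<lambda>t. h (Suc t)) (mset_set {0..<k})) =
      image_mset h (mset_set {0..<Suc k})"
  proof -
    have "image_mset (\<lambda>t. h (Suc t)) (mset_set {0..<k}) = image_mset h (mset_set {1..<Suc k})"
    proof -
      have "image_mset Suc (mset_set {0..<k}) = mset_set {1..<Suc k}"
        by (simp add: image_mset_mset_set)
      moreover have "image_mset (\<lambda>t. h (Suc t)) M = image_mset h (image_mset Suc M)" for M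
        by (simp add: multiset.map_comp o_def)
      ultimately show ?thesis by simp
    qed
    moreover have "{0..<Suc k} = insert 0 {1..<Suc k}" by auto
    ultimately show ?thesis by simp
  qed
  also have "\<dots> = add_mset (h 0) (image_mset h (mset_set {0..<k}))"
    by (simp add: atLeast0_lessThan_Suc per)
  finally show ?case using Suc by (simp add: h_def)
qed simp

theorem theorem3p18:
  fixes k a b x :: nat and d :: int and T :: tableau
  assumes "k \<ge> 1" and "a \<ge> 1" and "b \<ge> 1"
    and "T \<in> SSYT k a b"
    and "x \<in> {1..a}"
  shows "BCDist k a b T (a + 1 - x) (int k - d) = {# b - m. m \<in># BCDist k a b T x d #}"
proof -
  interpret promotion_orbit k a b T by unfold_locales (use assms in auto)
  define x' where "x' = a + 1 - x"
  have x: "1 \<le> x" "x \<le> a" "1 \<le> x'" "x' \<le> a" using assms(5) by (auto simp: x'_def)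
  have full: "N t y e = b" if "1 \<le> y" "y \<le> a" "k \<le> e" for t y e
    unfolding N_def using that by (intro entry_count_full[OF orbit_SSYT]) auto
  have N_le: "N t y e \<le> b" for t y e unfolding N_def by (rule entry_count_le)
  have BC: "BCDist k a b T y c =
      image_mset (\<lambda>t. if c < 0 then b else b - N t y (nat c)) (mset_set {0..<k})"
    if "1 \<le> y" "y \<le> a" for y c
    unfolding BCDist_def using card_gt[OF that] by simp
  \<comment> \<open>In the first two cases one multiset consists of zeros and the other of copies of
    \<open>b\<close>, as all entries lie between \<open>1\<close> and \<open>k\<close>.\<close>
  consider "d < 0" | "int k < d" | "0 \<le> d" "d \<le> int k" by linarith
  then show ?thesis
  proof cases
    case 1
    then have "k \<le> nat (int k - d)" by simp
    then show ?thesis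
      using 1 full[OF x(3,4)] unfolding x'_def[symmetric] BC[OF x(1,2)] BC[OF x(3,4)]
      by (simp add: multiset.map_comp o_def)
  next
    case 2
    then have "k \<le> nat d" by simp
    then show ?thesis
      using 2 full[OF x(1,2)] unfolding x'_def[symmetric] BC[OF x(1,2)] BC[OF x(3,4)]
      by (simp add: multiset.map_comp o_def)
  next
    case 3
    define e where "e = nat d"
    have e: "e \<le> k" "nat (int k - d) = k - e" using 3 by (auto simp: e_def)
    \<comment> \<open>\<open>g\<close> produces the left-hand side. At lag \<open>e\<close> it
      becomes the complement by \<open>N_complement\<close>, and periodicity absorbs the
      lag.\<close>
    define g where "g = (\<lambda>t. b - N t x' (k - e))"
    have "g (t + k) = g t" for t using N_periodic[of x' "k - e" t] x by (simp add: g_def)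
    then have "image_mset (\<lambda>t. g (t + e)) (mset_set {0..<k}) = image_mset g (mset_set {0..<k})"
      by (rule image_mset_shift_periodic)
    moreover have "g (t + e) = b - (b - N t x e)" for t
      using N_complement[OF x(1,2) e(1), of t] by (simp add: g_def x'_def)
    moreover have "BCDist k a b T x' (int k - d) = image_mset g (mset_set {0..<k})"
      using 3 e unfolding BC[OF x(3,4)] by (simp add: g_def)
    moreover have "{# b - m. m \<in># BCDist k a b T x d #} =
        image_mset (\<lambda>t. b - (b - N t x e)) (mset_set {0..<k})"
      using 3 unfolding BC[OF x(1,2)] by (simp add: e_def multiset.map_comp o_def)
    ultimately show ?thesis unfolding x'_def[symmetric] by simp
  qed
qed

end
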